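(* (i) Let $S\equiv\pm\{1, 3, 4, 5, 7, 22, 23, 24, 25, 26, 27, 29\}\pmod{60}$ and $T\equiv\pm\{1, 2, 3, 7, 11, 19, 23, 24, 26, 27, 28, 29\}\pmod{60}$. Then $p(S,n)=p(T,n-1)$ for all $n\geq 1$. (ii) Let $S\equiv\pm\{2, 7, 9, 11, 12, 13, 14, 16, 17, 19, 21, 23\}\pmod{60}$ and $T\equiv\pm\{2, 5, 7, 9, 11, 12, 19, 21, 23, 25, 26, 28\}\pmod{60}$. Then $p(S,n)=p(T,n-2)$ for all $n\geq 2$. (iii) Let $S\equiv\pm\{2, 3, 5, 11, 13, 14, 16, 17, 19, 24, 25, 27\}\pmod{60}$ and $T\equiv\pm\{1, 3, 8, 11, 13, 14, 17, 19, 22, 24, 27, 29\}\pmod{60}$. Then $p(S,n)=p(T,n-2)$ for all $n\geq 2$. (iv) Let $S\equiv\pm\{1, 5, 8, 9, 12, 13, 14, 17, 21, 22, 25, 29\}\pmod{60}$ and $T\equiv\pm\{1, 4, 7, 9, 12, 13, 17, 21, 22, 23, 26, 29\}\pmod{60}$. Then $p(S,n)=p(T,n-1)$ for all $n\geq 1$.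
   Context: For a set $S$ of positive integers and an integer $n\ge 0$, $p(S,n)$ denotes the number of partitions of $n$ into parts belonging to $S$ (so $p(S,0)=1$). The notation $S\equiv\pm\{r_1,\dots,r_k\}\pmod M$ means that $S$ is the set of all positive integers $n$ such that $n\equiv r_i$ or $n\equiv -r_i\pmod M$ for some $i$. *)

theory Defs
  imports "HOL-Library.Multiset" "HOL-Number_Theory.Cong"
begin

text \<open>A partition is the finite multiset of its parts. The definition is intended for sets \<open>S\<close>
  of positive integers; then the set being counted is finite (lemma \<open>finite_partitions_into\<close>),
  so that \<open>card\<close> is the true count.\<close>

definition partitions_into :: "nat set \<Rightarrow> nat \<Rightarrow> nat multiset set" where
  "partitions_into S n = {P. set_mset P \<subseteq> S \<and> sum_mset P = n}"

definition num_partitions :: "nat set \<Rightarrow> nat \<Rightarrow> nat" where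
  "num_partitions S n = card (partitions_into S n)"

definition pm_residues :: "int set \<Rightarrow> int \<Rightarrow> nat set" where
  "pm_residues R M = {n. n > 0 \<and> (\<exists>r\<in>R. [int n = r] (mod M) \<or> [int n = - r] (mod M))}"

lemma size_le_sum_mset:
  fixes P :: "nat multiset"
  assumes "0 \<notin># P"
  shows "size P \<le> sum_mset P"
  using assms by (induction P) auto

lemma finite_partitions_into:
  assumes "0 \<notin> S"
  shows "finite (partitions_into S n)"
proof (rule finite_subset)
  show "partitions_into S n \<subseteq> mset ` {xs. set xs \<subseteq> {..n} \<and> length xs \<le> n}"
  proof
    fix P assume P: "P \<in> partitions_into S n"
    obtain xs where xs: "P = mset xs" by (metis ex_mset)
    have "0 \<notin># P" using P assms by (auto simp: partitions_into_def)
    then have "length xs \<le> n"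
      using P size_le_sum_mset[of P] by (simp add: partitions_into_def xs)
    moreover have "x \<le> n" if "x \<in> set xs" for x
      using P member_le_sum_list[OF that] by (simp add: partitions_into_def xs sum_mset_sum_list)
    ultimately show "P \<in> mset ` {xs. set xs \<subseteq> {..n} \<and> length xs \<le> n}"
      using xs by auto
  qed
  show "finite (mset ` {xs. set xs \<subseteq> {..n} \<and> length xs \<le> n})"
    by (intro finite_imageI finite_lists_length_le) simp
qed

end

theory Submission
  imports Defs "HOL-Analysis.Analysis"
begin

text \<open>
  Write \<open>\<theta>(x; Q) = \<Prod>(1 - x Q\<^sup>k)(1 - Q\<^sup>k\<^sup>+\<^sup>1/x)\<close> and \<open>J\<^sub>r = \<theta>(q\<^sup>r; q\<^sup>6\<^sup>0)\<close>. The generating function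
  of the partitions with parts congruent to plus or minus an element of \<open>R\<close> modulo 60 is the
  reciprocal of the product of the \<open>J\<^sub>r\<close>, \<open>r \<in> R\<close>, so each of the four claims says that
  \<open>1/\<Prod>J\<^sub>s - q\<^sup>e/\<Prod>J\<^sub>t = 1\<close>. Each of these is a single instance of Weierstrass'
  three-term relation for \<open>\<theta>(_; q\<^sup>3\<^sup>0)\<close>, taken at four points of the form \<open>q\<^sup>a\<close> or \<open>- q\<^sup>a\<close>, because
  \<open>\<theta>(q\<^sup>r; q\<^sup>3\<^sup>0) = J\<^sub>r J\<^sub>3\<^sub>0\<^sub>-\<^sub>r\<close> and \<open>\<theta>(- q\<^sup>r; q\<^sup>3\<^sup>0) = J\<^sub>2\<^sub>r / (J\<^sub>r J\<^sub>3\<^sub>0\<^sub>-\<^sub>r)\<close>.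

  The Jacobi triple product turns \<open>y \<theta>(xy) \<theta>(x/y)\<close> into a double series; splitting it by the parity
  of the sum of the indices gives \<open>A(x) B(y) - B(x) A(y)\<close> up to a constant factor, and Weierstrass'
  relation becomes the Pluecker relation between 2 by 2 minors.
\<close>

section \<open>Generating functions of partitions\<close>

lemma num_partitions_empty: "num_partitions {} n = (if n = 0 then 1 else 0)"
proof -
  have "partitions_into {} n = (if n = 0 then {{#}} else {})"
    by (auto simp: partitions_into_def)
  then show ?thesis by (simp add: num_partitions_def)
qed

lemma num_partitions_singleton:
  assumes "0 < m"
  shows "num_partitions {m} n = (if m dvd n then 1 else 0)"
proof -
  have "P \<in> partitions_into {m} n \<longleftrightarrow> m dvd n \<and> P = replicate_mset (n div m) m" for P
  proof
    assume P: "P \<in> partitions_into {m} n"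
    then obtain k where k: "P = replicate_mset k m"
      by (auto simp: partitions_into_def dest: set_mset_subset_singletonD)
    with P have "k * m = n" by (simp add: partitions_into_def)
    with k show "m dvd n \<and> P = replicate_mset (n div m) m"
      using assms by auto
  qed (auto simp: partitions_into_def split: if_splits)
  then have "partitions_into {m} n = (if m dvd n then {replicate_mset (n div m) m} else {})"
    by auto
  then show ?thesis by (simp add: num_partitions_def)
qed

lemma num_partitions_Un:
  assumes "S \<inter> T = {}" "0 \<notin> S" "0 \<notin> T"
  shows "num_partitions (S \<union> T) n = (\<Sum>i\<le>n. num_partitions S i * num_partitions T (n - i))"
proof -
  let ?split = "\<lambda>P. (filter_mset (\<lambda>x. x \<in> S) P, filter_mset (\<lambda>x. x \<notin> S) P)"
  let ?pairs = "\<lambda>i. partitions_into S i \<times> partitions_into T (n - i)"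
  have "bij_betw ?split (partitions_into (S \<union> T) n) (\<Union>i\<le>n. ?pairs i)"
  proof (rule bij_betw_byWitness[where f' = "\<lambda>(P, Q). P + Q"])
    show "\<forall>P\<in>partitions_into (S \<union> T) n. (\<lambda>(P, Q). P + Q) (?split P) = P"
      by simp
    show "\<forall>PQ\<in>\<Union>i\<le>n. ?pairs i. ?split ((\<lambda>(P, Q). P + Q) PQ) = PQ"
    proof
      fix PQ assume "PQ \<in> (\<Union>i\<le>n. ?pairs i)"
      then obtain P Q where "PQ = (P, Q)" and "\<And>x. x \<in># P \<Longrightarrow> x \<in> S" "\<And>x. x \<in># Q \<Longrightarrow> x \<notin> S"
        using assms(1) by (fastforce simp: partitions_into_def)
      then show "?split ((\<lambda>(P, Q). P + Q) PQ) = PQ"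
        by (auto intro!: multiset_eqI simp: count_eq_zero_iff)
    qed
    show "?split ` partitions_into (S \<union> T) n \<subseteq> (\<Union>i\<le>n. ?pairs i)"
    proof clarify
      fix P assume P: "P \<in> partitions_into (S \<union> T) n"
      have "sum_mset (filter_mset (\<lambda>x. x \<in> S) P) + sum_mset (filter_mset (\<lambda>x. x \<notin> S) P) = n"
        using P by (simp add: partitions_into_def flip: sum_mset.union)
      then show "?split P \<in> (\<Union>i\<le>n. ?pairs i)"
        using P by (auto simp: partitions_into_def)
    qed
  qed (auto simp: partitions_into_def)
  then have "num_partitions (S \<union> T) n = card (\<Union>i\<le>n. ?pairs i)"
    unfolding num_partitions_def by (rule bij_betw_same_card)
  also have "\<dots> = (\<Sum>i\<le>n. card (?pairs i))"
  proof (intro card_UN_disjoint ballI impI)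
    show "finite (?pairs i)" for i
      using assms by (simp add: finite_partitions_into)
  qed (auto simp: partitions_into_def)
  finally show ?thesis by (simp add: card_cartesian_product num_partitions_def)
qed

lemma num_partitions_Int_lessThan:
  assumes "n < N"
  shows "num_partitions (S \<inter> {..<N}) n = num_partitions S n"
proof -
  have "x \<le> n" if "x \<in># P" "sum_mset P = n" for x P
    using that by (auto dest: multi_member_split)
  then have "partitions_into (S \<inter> {..<N}) n = partitions_into S n"
    using assms by (fastforce simp: partitions_into_def)
  then show ?thesis by (simp add: num_partitions_def)
qed

lemma num_partitions_mono:
  assumes "S \<subseteq> T" "0 \<notin> T"
  shows "num_partitions S n \<le> num_partitions T n"
  unfolding num_partitions_def using assms
  by (intro card_mono finite_partitions_into) (auto simp: partitions_into_def)

lemma norm_power_less_one: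
  fixes q :: "'a :: real_normed_div_algebra"
  assumes "norm q < 1" "0 < n"
  shows "norm (q ^ n) < 1"
  using assms by (simp add: norm_power power_less_one_iff)

lemma sums_num_partitions_singleton:
  fixes q :: "'a :: {real_normed_field, banach}"
  assumes "norm q < 1" "0 < m"
  shows "(\<lambda>n. of_nat (num_partitions {m} n) * q ^ n) sums inverse (1 - q ^ m)"
proof (subst sums_mono_reindex[where g = "\<lambda>k. m * k", symmetric])
  show "strict_mono (\<lambda>k. m * k)" using assms by (simp add: strict_mono_def)
  show "of_nat (num_partitions {m} n) * q ^ n = 0" if "n \<notin> range (\<lambda>k. m * k)" for n
    using that assms by (auto simp: num_partitions_singleton elim!: dvdE)
  show "(\<lambda>k. of_nat (num_partitions {m} (m * k)) * q ^ (m * k)) sums inverse (1 - q ^ m)"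
    using geometric_sums[OF norm_power_less_one[OF assms]] assms
    by (simp add: num_partitions_singleton power_mult inverse_eq_divide)
qed

lemma sums_num_partitions_Un:
  fixes q :: "'a :: {real_normed_field, banach}"
  assumes disjoint: "S \<inter> T = {}" "0 \<notin> S" "0 \<notin> T"
    and abs_S: "summable (\<lambda>n. norm (of_nat (num_partitions S n) * q ^ n))"
    and S: "(\<lambda>n. of_nat (num_partitions S n) * q ^ n) sums A"
    and abs_T: "summable (\<lambda>n. norm (of_nat (num_partitions T n) * q ^ n))"
    and T: "(\<lambda>n. of_nat (num_partitions T n) * q ^ n) sums B"
  shows "summable (\<lambda>n. norm (of_nat (num_partitions (S \<union> T) n) * q ^ n))"
    and "(\<lambda>n. of_nat (num_partitions (S \<union> T) n) * q ^ n) sums (A * B)"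
proof -
  have convolution: "of_nat (num_partitions (S \<union> T) n) * z ^ n =
      (\<Sum>i\<le>n. (of_nat (num_partitions S i) * z ^ i) *
        (of_nat (num_partitions T (n - i)) * z ^ (n - i)))"
    for z :: "'b :: {real_normed_field, banach}" and n
  proof -
    have "of_nat (num_partitions (S \<union> T) n) * z ^ n =
        (\<Sum>i\<le>n. of_nat (num_partitions S i) * of_nat (num_partitions T (n - i)) *
          (z ^ i * z ^ (n - i)))"
      by (simp add: num_partitions_Un[OF disjoint] sum_distrib_right flip: power_add)
    then show ?thesis by (simp add: mult_ac)
  qed
  show "summable (\<lambda>n. norm (of_nat (num_partitions (S \<union> T) n) * q ^ n))"
    using summable_Cauchy_product[of "\<lambda>n. of_nat (num_partitions S n) * norm q ^ n"
        "\<lambda>n. of_nat (num_partitions T n) * norm q ^ n"] abs_S abs_T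
    by (simp add: norm_mult norm_power convolution[of _ "norm q", symmetric])
  show "(\<lambda>n. of_nat (num_partitions (S \<union> T) n) * q ^ n) sums (A * B)"
    using Cauchy_product_sums[OF abs_S abs_T] sums_unique[OF S] sums_unique[OF T]
    by (simp add: convolution)
qed

lemma sums_num_partitions_finite:
  fixes q :: "'a :: {real_normed_field, banach}"
  assumes "finite S" "0 \<notin> S" "norm q < 1"
  shows "summable (\<lambda>n. norm (of_nat (num_partitions S n) * q ^ n)) \<and>
    (\<lambda>n. of_nat (num_partitions S n) * q ^ n) sums inverse (\<Prod>m\<in>S. 1 - q ^ m)"
  using assms(1,2)
proof (induction S rule: finite_induct)
  case empty
  have "(\<lambda>n. of_nat (num_partitions {} n) * q ^ n) sums 1"
    using sums_single[of 0 "\<lambda>n. of_nat (num_partitions {} n) * q ^ n"]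
    by (simp add: num_partitions_empty if_distrib[of of_nat] if_distrib[of "\<lambda>z. z * _"]
        cong: if_cong)
  moreover have "summable (\<lambda>n. norm (of_nat (num_partitions {} n) * q ^ n))"
    by (rule summable_finite[of "{0}"]) (auto simp: num_partitions_empty)
  ultimately show ?case by simp
next
  case (insert m S)
  then have m: "0 < m" "m \<notin> S" "0 \<notin> S" by (auto intro: Nat.gr0I)
  have "norm (norm q) < 1" using assms(3) by simp
  from sums_num_partitions_singleton[OF this m(1)]
  have abs_m: "summable (\<lambda>n. norm (of_nat (num_partitions {m} n) * q ^ n))"
    by (simp add: norm_mult norm_power sums_iff)
  have disjoint: "{m} \<inter> S = {}" "0 \<notin> {m}" "0 \<notin> S" using m by auto
  note IH = insert.IH[OF m(3), THEN conjunct1] insert.IH[OF m(3), THEN conjunct2]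
  note sums_m = sums_num_partitions_singleton[OF assms(3) m(1)]
  show ?case
    using sums_num_partitions_Un[OF disjoint abs_m sums_m IH] insert.hyps by simp
qed

lemma convergent_prod_one_minus_bounded:
  fixes q :: "'a :: {real_normed_field, banach}"
  assumes "norm q < 1" and "\<And>k. norm (c k) \<le> C"
  shows "convergent_prod (\<lambda>k. 1 - c k * q ^ k)"
proof -
  have "summable (\<lambda>k. C * norm q ^ k)"
    using assms(1) by (intro summable_mult summable_geometric) simp
  then have "summable (\<lambda>k. norm ((1 - c k * q ^ k) - 1))"
    by (rule summable_comparison_test') (simp add: norm_mult norm_power mult_right_mono assms(2))
  then show ?thesis
    by (intro abs_convergent_prod_imp_convergent_prod summable_imp_abs_convergent_prod)
qed

definition euler_product :: "nat set \<Rightarrow> 'a :: {real_normed_field, banach} \<Rightarrow> 'a" where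
  "euler_product S q = (\<Prod>m. if m \<in> S then 1 - q ^ m else 1)"

lemma convergent_prod_euler_product:
  fixes q :: "'a :: {real_normed_field, banach}"
  assumes "norm q < 1"
  shows "convergent_prod (\<lambda>m. if m \<in> S then 1 - q ^ m else 1)"
proof -
  have "convergent_prod (\<lambda>m. 1 - (if m \<in> S then 1 else 0) * q ^ m)"
    by (rule convergent_prod_one_minus_bounded[OF assms, where C = 1]) simp
  then show ?thesis by (simp add: if_distrib[of "\<lambda>c. 1 - c * _"] cong: if_cong)
qed

lemma euler_product_nonzero:
  assumes "0 \<notin> S" "norm q < 1"
  shows "euler_product S q \<noteq> 0"
  unfolding euler_product_def
proof (intro prodinf_nonzero convergent_prod_euler_product assms)
  show "(if m \<in> S then 1 - q ^ m else 1) \<noteq> 0" for m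
    using assms norm_power_less_one[of q m] by (cases "m = 0") auto
qed

lemma euler_product_LIMSEQ:
  assumes "norm q < 1"
  shows "(\<lambda>N. \<Prod>m\<in>S \<inter> {..<N}. 1 - q ^ m) \<longlonglongrightarrow> euler_product S q"
proof -
  have "(\<lambda>N. \<Prod>m<N. if m \<in> S then 1 - q ^ m else 1) \<longlonglongrightarrow> euler_product S q"
    unfolding euler_product_def
    by (intro has_prod_imp_tendsto' convergent_prod_has_prod convergent_prod_euler_product assms)
  then show ?thesis by (simp add: prod.inter_restrict[symmetric] Int_commute)
qed

lemma summable_num_partitions:
  fixes r :: real
  assumes "0 \<notin> S" "0 \<le> r" "r < 1"
  shows "summable (\<lambda>n. of_nat (num_partitions S n) * r ^ n)"
proof -
  have norm_r: "norm r < 1" using assms by simp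
  let ?F = "\<lambda>N. inverse (\<Prod>m\<in>S \<inter> {..<N}. 1 - r ^ m)"
  have "Bseq ?F"
    using tendsto_inverse[OF euler_product_LIMSEQ[OF norm_r]
        euler_product_nonzero[OF assms(1) norm_r]]
    by (rule convergentI[THEN convergent_imp_Bseq])
  then obtain K where norm_le_K: "norm (?F N) \<le> K" for N by (elim BseqE) blast
  have "(\<Sum>n<N. norm (of_nat (num_partitions S n) * r ^ n)) \<le> K" for N
  proof -
    have sums_F: "(\<lambda>n. of_nat (num_partitions (S \<inter> {..<N}) n) * r ^ n) sums ?F N"
      using sums_num_partitions_finite[of "S \<inter> {..<N}" r] assms norm_r by simp
    have "(\<Sum>n<N. norm (of_nat (num_partitions S n) * r ^ n)) =
        (\<Sum>n<N. of_nat (num_partitions (S \<inter> {..<N}) n) * r ^ n)"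
      using assms by (simp add: num_partitions_Int_lessThan)
    also have "\<dots> \<le> ?F N"
      using sum_le_suminf[OF sums_summable[OF sums_F], of "{..<N}"] assms
      by (simp add: sums_unique[OF sums_F, symmetric])
    also have "\<dots> \<le> norm (?F N)" by (simp only: real_norm_def abs_ge_self)
    also have "\<dots> \<le> K" by (rule norm_le_K)
    finally show ?thesis .
  qed
  then show ?thesis by (intro summable_norm_cancel[OF summableI_nonneg_bounded]) auto
qed

theorem sums_num_partitions:
  fixes q :: "'a :: {real_normed_field, banach}"
  assumes "0 \<notin> S" "norm q < 1"
  shows "(\<lambda>n. of_nat (num_partitions S n) * q ^ n) sums inverse (euler_product S q)"
proof -
  let ?a = "\<lambda>n N. of_nat (num_partitions (S \<inter> {..<N}) n) * q ^ n"
  let ?b = "\<lambda>n. of_nat (num_partitions S n) * q ^ n"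
  have "((\<lambda>N. ?a n N) \<longlonglongrightarrow> ?b n)" for n
    by (intro tendsto_eventually eventually_mono[OF eventually_gt_at_top[of n]])
      (simp add: num_partitions_Int_lessThan)
  moreover have "eventually (\<lambda>(n, N). norm (?a n N) \<le> of_nat (num_partitions S n) * norm q ^ n)
      (sequentially \<times>\<^sub>F sequentially)"
    using assms
    by (auto simp: norm_mult norm_power
        intro!: always_eventually mult_right_mono num_partitions_mono)
  moreover have "summable (\<lambda>n. real (num_partitions S n) * norm q ^ n)"
    using summable_num_partitions[of S "norm q"] assms by simp
  ultimately have "summable (\<lambda>n. norm (?b n))" and "(\<lambda>N. \<Sum>n. ?a n N) \<longlonglongrightarrow> (\<Sum>n. ?b n)"
    using tannerys_theorem[of ?a ?b sequentially "\<lambda>n. of_nat (num_partitions S n) * norm q ^ n"]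
    by simp_all
  moreover have "(\<Sum>n. ?a n N) = inverse (\<Prod>m\<in>S \<inter> {..<N}. 1 - q ^ m)" for N
    using sums_num_partitions_finite[of "S \<inter> {..<N}" q] assms by (simp add: sums_iff)
  moreover have "(\<lambda>N. inverse (\<Prod>m\<in>S \<inter> {..<N}. 1 - q ^ m)) \<longlonglongrightarrow> inverse (euler_product S q)"
    by (intro tendsto_inverse euler_product_LIMSEQ euler_product_nonzero assms)
  ultimately show ?thesis
    using LIMSEQ_unique by (auto simp: sums_iff intro: summable_norm_cancel)
qed

lemma powser_sums_0_imp_coeff_0:
  fixes h :: "nat \<Rightarrow> 'a :: {real_normed_field, banach}"
  assumes "0 < r" and "\<And>q. q \<noteq> 0 \<Longrightarrow> norm q < r \<Longrightarrow> (\<lambda>n. h n * q ^ n) sums 0"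
  shows "h n = 0"
proof (induction n rule: less_induct)
  case (less n)
  have "(\<lambda>k. h (k + n) * q ^ k) sums 0" if q: "q \<noteq> 0" "norm q < r" for q
  proof -
    have "(\<lambda>k. h (k + n) * q ^ (k + n)) sums 0"
      using assms(2)[OF q] less by (subst sums_iff_shift) simp
    from sums_mult[OF this, of "inverse (q ^ n)"] show ?thesis
      using q by (simp add: power_add field_simps)
  qed
  then have "((\<lambda>_. 0) \<longlongrightarrow> h (0 + n)) (at (0 :: 'a))"
    using \<open>0 < r\<close> by (intro powser_limit_0_strong[where a = "\<lambda>k. h (k + n)"]) auto
  then show ?case using tendsto_const_iff[of "at (0 :: 'a)"] by (simp add: tendsto_const_iff)
qed

lemma powser_coeff_shift:
  fixes a b :: "nat \<Rightarrow> 'a :: {real_normed_field, banach}"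
  assumes a: "\<And>q. q \<noteq> 0 \<Longrightarrow> norm q < r \<Longrightarrow> (\<lambda>n. a n * q ^ n) sums A q"
    and b: "\<And>q. q \<noteq> 0 \<Longrightarrow> norm q < r \<Longrightarrow> (\<lambda>n. b n * q ^ n) sums B q"
    and eq: "\<And>q. q \<noteq> 0 \<Longrightarrow> norm q < r \<Longrightarrow> A q - q ^ e * B q = 1"
    and "0 < r" "0 < e" "e \<le> n"
  shows "a n = b (n - e)"
proof -
  define h where "h n = a n - (if n < e then 0 else b (n - e)) - (if n = 0 then 1 else 0)" for n
  have "(\<lambda>n. h n * q ^ n) sums 0" if q: "q \<noteq> 0" "norm q < r" for q
  proof -
    have "(\<lambda>n. if n < e then 0 else b (n - e) * q ^ n) sums (q ^ e * B q)"
    proof (subst sums_iff_shift'[of _ e, symmetric])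
      show "(\<lambda>n. if n + e < e then 0 else b (n + e - e) * q ^ (n + e)) sums
          (q ^ e * B q - (\<Sum>n<e. if n < e then 0 else b (n - e) * q ^ n))"
        using sums_mult[OF b[OF q], of "q ^ e"] by (simp add: power_add mult_ac sum.neutral)
    qed
    moreover have "(\<lambda>n. if n = 0 then 1 else 0) sums (1 :: 'a)"
      using sums_single[of 0 "\<lambda>_. 1 :: 'a"] by simp
    ultimately have "(\<lambda>n. a n * q ^ n - (if n < e then 0 else b (n - e) * q ^ n) -
        (if n = 0 then 1 else 0)) sums (A q - q ^ e * B q - 1)"
      by (intro sums_diff a[OF q])
    moreover have "a n * q ^ n - (if n < e then 0 else b (n - e) * q ^ n) -
        (if n = 0 then 1 else 0) = h n * q ^ n" for n
      by (simp add: h_def left_diff_distrib)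
    ultimately show ?thesis using eq[OF q] by simp
  qed
  then have "h n = 0" by (rule powser_sums_0_imp_coeff_0[OF \<open>0 < r\<close>])
  then show ?thesis using \<open>0 < e\<close> \<open>e \<le> n\<close> by (simp add: h_def)
qed

section \<open>The Jacobi triple product\<close>

definition qpochhammer :: "nat \<Rightarrow> 'a :: comm_ring_1 \<Rightarrow> 'a \<Rightarrow> 'a" where
  "qpochhammer n a q = (\<Prod>k<n. 1 - a * q ^ k)"

definition qpochhammer_inf :: "'a :: {real_normed_field, banach} \<Rightarrow> 'a \<Rightarrow> 'a" where
  "qpochhammer_inf a q = (\<Prod>k. 1 - a * q ^ k)"

definition qtheta :: "'a :: {real_normed_field, banach} \<Rightarrow> 'a \<Rightarrow> 'a" where
  "qtheta x q = qpochhammer_inf x q * qpochhammer_inf (q / x) q"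

lemma convergent_prod_qpochhammer:
  fixes q :: "'a :: {real_normed_field, banach}"
  assumes "norm q < 1"
  shows "convergent_prod (\<lambda>k. 1 - a * q ^ k)"
  using convergent_prod_one_minus_bounded[OF assms order_refl] .

lemma qpochhammer_add: "qpochhammer (m + n) a q = qpochhammer m a q * qpochhammer n (a * q ^ m) q"
  by (induction n) (simp_all add: qpochhammer_def power_add mult_ac)

lemma qpochhammer_LIMSEQ:
  assumes "norm q < 1"
  shows "(\<lambda>n. qpochhammer n a q) \<longlonglongrightarrow> qpochhammer_inf a q"
  unfolding qpochhammer_def qpochhammer_inf_def
  by (intro has_prod_imp_tendsto' convergent_prod_has_prod convergent_prod_qpochhammer assms)

lemma one_minus_mult_power_nonzero:
  fixes a q :: "'a :: real_normed_div_algebra"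
  assumes "norm q < 1" "norm a < 1"
  shows "1 - a * q ^ k \<noteq> 0"
proof -
  have "norm (a * q ^ k) \<le> norm a * 1"
    unfolding norm_mult norm_power using assms by (intro mult_left_mono power_le_one) auto
  then show ?thesis using assms by auto
qed

lemma qpochhammer_nonzero:
  fixes a q :: "'a :: real_normed_field"
  assumes "norm q < 1" "norm a < 1"
  shows "qpochhammer n a q \<noteq> 0"
  unfolding qpochhammer_def using one_minus_mult_power_nonzero[OF assms] by simp

lemma qpochhammer_inf_nonzero:
  assumes "norm q < 1" "norm a < 1"
  shows "qpochhammer_inf a q \<noteq> 0"
  unfolding qpochhammer_inf_def using assms
  by (intro prodinf_nonzero convergent_prod_qpochhammer one_minus_mult_power_nonzero)

fun qbinomial :: "'a :: comm_ring_1 \<Rightarrow> nat \<Rightarrow> nat \<Rightarrow> 'a" where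
  "qbinomial q n 0 = 1"
| "qbinomial q 0 (Suc k) = 0"
| "qbinomial q (Suc n) (Suc k) = qbinomial q n k + q ^ Suc k * qbinomial q n (Suc k)"

lemma qbinomial_eq_0: "n < k \<Longrightarrow> qbinomial q n k = 0"
  by (induction q n k rule: qbinomial.induct) auto

lemma qbinomial_self: "qbinomial q n n = 1"
  by (induction n) (auto simp: qbinomial_eq_0)

lemma qbinomial_theorem:
  "qpochhammer n (- y) q = (\<Sum>k\<le>n. q ^ (k choose 2) * y ^ k * qbinomial q n k)"
proof (induction n arbitrary: y)
  case (Suc n)
  let ?t = "\<lambda>n k. q ^ (k choose 2) * y ^ k * qbinomial q n k"
  let ?s = "\<lambda>k. q ^ (k choose 2) * (y * q) ^ k * qbinomial q n k"
  have "(\<Sum>k\<le>n. ?s k) = (\<Sum>k\<le>Suc n. ?s k)"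
    by (simp add: qbinomial_eq_0)
  also have "\<dots> = 1 + (\<Sum>k\<le>n. ?s (Suc k))"
    by (simp add: sum.atMost_Suc_shift binomial_eq_0 del: sum.atMost_Suc)
  finally have split_first: "(\<Sum>k\<le>n. ?s k) = 1 + (\<Sum>k\<le>n. ?s (Suc k))" .
  have "qpochhammer (Suc n) (- y) q = (1 + y) * qpochhammer n (- (y * q)) q"
    using qpochhammer_add[of 1 n "- y" q] by (simp add: qpochhammer_def)
  also have "\<dots> = (\<Sum>k\<le>n. ?s k) + y * (\<Sum>k\<le>n. ?s k)"
    unfolding Suc.IH by (simp only: distrib_right mult_1)
  also have "\<dots> = 1 + (\<Sum>k\<le>n. ?s (Suc k) + y * ?s k)"
    by (subst split_first) (simp only: add.assoc sum.distrib sum_distrib_left)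
  also have "(\<Sum>k\<le>n. ?s (Suc k) + y * ?s k) = (\<Sum>k\<le>n. ?t (Suc n) (Suc k))"
    by (intro sum.cong) (auto simp: numeral_2_eq_2 power_add power_mult_distrib algebra_simps)
  also have "1 + \<dots> = (\<Sum>k\<le>Suc n. ?t (Suc n) k)"
    by (simp add: sum.atMost_Suc_shift binomial_eq_0 del: sum.atMost_Suc qbinomial.simps(3))
  finally show ?case .
qed (simp add: qpochhammer_def binomial_eq_0)

lemma qbinomial_qpochhammer:
  "qbinomial q (m + k) k * qpochhammer m q q * qpochhammer k q q = qpochhammer (m + k) q q"
proof (induction k arbitrary: m)
  case 0
  show ?case by (simp add: qpochhammer_def)
next
  case (Suc k)
  note IH_k = Suc.IH
  show ?case
  proof (induction m)
    case 0
    show ?case by (simp add: qbinomial_self qpochhammer_def del: qbinomial.simps)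
  next
    case (Suc m)
    let ?P = "\<lambda>n. qpochhammer n q q"
    have P_Suc: "?P (Suc n) = ?P n * (1 - q ^ Suc n)" for n
      by (simp add: qpochhammer_def)
    have "qbinomial q (Suc m + Suc k) (Suc k) * ?P (Suc m) * ?P (Suc k) =
        (qbinomial q (Suc m + k) k * ?P (Suc m) * ?P k) * (1 - q ^ Suc k) +
        q ^ Suc k * (qbinomial q (m + Suc k) (Suc k) * ?P m * ?P (Suc k)) * (1 - q ^ Suc m)"
      by (simp add: P_Suc algebra_simps)
    also have "\<dots> = ?P (Suc (m + k)) * (1 - q ^ Suc k + q ^ Suc k * (1 - q ^ Suc m))"
      unfolding IH_k Suc.IH by (simp add: algebra_simps)
    also have "\<dots> = ?P (Suc m + Suc k)"
      by (simp add: P_Suc power_add algebra_simps)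
    finally show ?case .
  qed
qed

lemma qbinomial_eq_qpochhammer:
  fixes q :: "'a :: real_normed_field"
  assumes "norm q < 1"
  shows "qbinomial q (m + k) k = qpochhammer (m + k) q q / (qpochhammer m q q * qpochhammer k q q)"
  using qbinomial_qpochhammer[of q m k] qpochhammer_nonzero[OF assms assms]
  by (simp add: field_simps)

lemma tendsto_qbinomial:
  fixes q :: "'a :: {real_normed_field, banach}"
  assumes q: "norm q < 1" and m: "filterlim m sequentially F" and k: "filterlim k sequentially F"
  shows "((\<lambda>n. qbinomial q (m n + k n) (k n)) \<longlongrightarrow> inverse (qpochhammer_inf q q)) F"
proof -
  have lim: "((\<lambda>n. qpochhammer (l n) q q) \<longlongrightarrow> qpochhammer_inf q q) F"
    if "filterlim l sequentially F" for l
    by (rule filterlim_compose[OF qpochhammer_LIMSEQ[OF q] that])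
  have "filterlim (\<lambda>n. m n + k n) sequentially F"
    using m by (rule filterlim_at_top_mono) simp
  then have "((\<lambda>n. qbinomial q (m n + k n) (k n)) \<longlongrightarrow>
      qpochhammer_inf q q / (qpochhammer_inf q q * qpochhammer_inf q q)) F"
    unfolding qbinomial_eq_qpochhammer[OF q] using qpochhammer_inf_nonzero[OF q q]
    by (intro tendsto_intros lim m k) auto
  then show ?thesis
    using qpochhammer_inf_nonzero[OF q q] by (simp add: field_simps)
qed

lemma tendsto_central_qbinomial:
  fixes q :: "'a :: {real_normed_field, banach}"
  assumes "norm q < 1"
  shows "(\<lambda>n. qbinomial q (2 * n) (nat (int n + j))) \<longlonglongrightarrow> inverse (qpochhammer_inf q q)"
proof (rule Lim_transform_eventually)
  have "filterlim (\<lambda>n. nat (int n + i)) sequentially sequentially" for i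
  proof -
    have "eventually (\<lambda>n. Z \<le> nat (int n + i)) sequentially" for Z
      using eventually_ge_at_top[of "Z + nat (- i)"] by eventually_elim linarith
    then show ?thesis by (simp add: filterlim_at_top)
  qed
  then show "(\<lambda>n. qbinomial q (nat (int n + - j) + nat (int n + j)) (nat (int n + j)))
      \<longlonglongrightarrow> inverse (qpochhammer_inf q q)"
    by (intro tendsto_qbinomial assms)
  show "eventually (\<lambda>n. qbinomial q (nat (int n + - j) + nat (int n + j)) (nat (int n + j)) =
      qbinomial q (2 * n) (nat (int n + j))) sequentially"
    using eventually_ge_at_top[of "nat \<bar>j\<bar>"]
  proof eventually_elim
    case (elim n)
    then have "nat (int n + - j) + nat (int n + j) = 2 * n" by linarith
    then show ?case by simp
  qed
qed

lemma bounded_qbinomial: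
  fixes q :: "'a :: {real_normed_field, banach}"
  assumes q: "norm q < 1"
  obtains C where "\<And>n k. norm (qbinomial q n k) \<le> C"
proof -
  let ?P = "\<lambda>n. qpochhammer n q q"
  have "convergent ?P" "convergent (\<lambda>n. inverse (?P n))"
    using qpochhammer_LIMSEQ[OF q, of q] qpochhammer_inf_nonzero[OF q q]
    by (auto simp: convergent_def intro: tendsto_inverse)
  then obtain A B where norm_le_A: "\<And>n. norm (?P n) \<le> A"
    and norm_le_B: "\<And>n. norm (inverse (?P n)) \<le> B"
    by (auto dest!: convergent_imp_Bseq elim!: BseqE)
  have "0 \<le> A" "0 \<le> B"
    using norm_le_A[of 0] norm_le_B[of 0] norm_ge_zero order_trans by blast+
  have "norm (qbinomial q n k) \<le> A * (B * B)" for n k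
  proof (cases "k \<le> n")
    case True
    then obtain m where "n = m + k" using le_Suc_ex by (metis add.commute)
    then have "norm (qbinomial q n k) =
        norm (?P n) * (norm (inverse (?P m)) * norm (inverse (?P k)))"
      by (simp add: qbinomial_eq_qpochhammer[OF q] divide_inverse norm_mult)
    also have "\<dots> \<le> A * (B * B)"
      using \<open>0 \<le> A\<close> \<open>0 \<le> B\<close> by (intro mult_mono norm_le_A norm_le_B) auto
    finally show ?thesis .
  next
    case False
    then show ?thesis using \<open>0 \<le> A\<close> by (simp add: qbinomial_eq_0)
  qed
  then show ?thesis by (rule that)
qed

definition theta_term :: "'a :: field \<Rightarrow> 'a \<Rightarrow> int \<Rightarrow> 'a" where
  "theta_term x q j = q powi (j * (j - 1) div 2) * x powi j"

lemma theta_term_add: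
  assumes "q \<noteq> 0" "x \<noteq> 0"
  shows "theta_term x q (i + j) = theta_term x q i * theta_term (x * q powi i) q j"
proof -
  have "(i + j) * (i + j - 1) div 2 = i * (i - 1) div 2 + (i * j + j * (j - 1) div 2)"
  proof -
    have "(i + j) * (i + j - 1) = i * (i - 1) + 2 * (i * j) + j * (j - 1)"
      by (simp add: algebra_simps)
    moreover have "even (i * (i - 1))" "even (j * (j - 1))" by simp_all
    ultimately show ?thesis by (simp add: div_plus_div_distrib_dvd_left)
  qed
  then show ?thesis
    using assms by (simp add: theta_term_def power_int_add power_int_mult_distrib power_int_mult)
qed

lemma theta_term_of_nat: "theta_term x q (int k) = q ^ (k choose 2) * x ^ k"
proof -
  have "int k * (int k - 1) div 2 = int (k choose 2)"
    by (cases k) (simp_all add: choose_two zdiv_int algebra_simps)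
  then show ?thesis by (simp add: theta_term_def)
qed

lemma theta_term_uminus:
  assumes "q \<noteq> 0"
  shows "theta_term x q (- j) = theta_term (q / x) q j"
proof -
  have "- j * (- j - 1) = j * (j - 1) + j * 2" by (simp add: algebra_simps)
  then have "- j * (- j - 1) div 2 = j * (j - 1) div 2 + j" by simp
  then show ?thesis
    using assms
    by (simp add: theta_term_def power_int_add power_int_minus power_int_divide_distrib)
      (simp add: divide_inverse)
qed

lemma qpochhammer_reverse:
  fixes x q :: "'a :: field"
  assumes "q \<noteq> 0" "x \<noteq> 0"
  shows "qpochhammer n (- (x / q ^ n)) q =
    theta_term (x / q ^ n) q (int n) * qpochhammer n (- (q / x)) q"
proof -
  have "qpochhammer n (- (x / q ^ n)) q =
      (\<Prod>k<n. x / q ^ n * q ^ k * (1 + q / x * q ^ (n - Suc k)))"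
    unfolding qpochhammer_def
  proof (intro prod.cong refl)
    fix k assume "k \<in> {..<n}"
    then have "q ^ n = q * q ^ (n - Suc k) * q ^ k"
      by (simp flip: power_Suc power_add)
    then show "1 - - (x / q ^ n) * q ^ k = x / q ^ n * q ^ k * (1 + q / x * q ^ (n - Suc k))"
      using assms by (simp add: field_simps)
  qed
  also have "\<dots> = (\<Prod>k<n. x / q ^ n * q ^ k) * qpochhammer n (- (q / x)) q"
    using prod.nat_diff_reindex[of "\<lambda>k. 1 + q / x * q ^ k" n]
    by (simp only: prod.distrib qpochhammer_def mult_minus_left diff_minus_eq_add)
  also have "(\<Prod>k<n. a * q ^ k) = q ^ (n choose 2) * a ^ n" for a
    by (induction n) (simp_all add: numeral_2_eq_2 power_add mult_ac)
  finally show ?thesis by (simp only: theta_term_of_nat)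
qed

lemma finite_jacobi_triple_product:
  fixes x q :: "'a :: field"
  assumes "q \<noteq> 0" "x \<noteq> 0"
  shows "qpochhammer n (- x) q * qpochhammer n (- (q / x)) q =
    (\<Sum>j\<in>{-int n..int n}. theta_term x q j * qbinomial q (2 * n) (nat (int n + j)))"
proof -
  define y where "y = x / q ^ n"
  define c where "c = theta_term y q (int n)"
  have y: "y \<noteq> 0" "y * q ^ n = x" using assms by (simp_all add: y_def)
  have "c \<noteq> 0" using assms y by (simp add: c_def theta_term_of_nat)
  have "c * (qpochhammer n (- x) q * qpochhammer n (- (q / x)) q) = qpochhammer (n + n) (- y) q"
    using qpochhammer_reverse[OF assms, of n] y by (simp add: qpochhammer_add c_def y_def)
  also have "\<dots> = (\<Sum>k\<le>2 * n. theta_term y q (int k) * qbinomial q (2 * n) k)"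
    by (simp only: qbinomial_theorem theta_term_of_nat flip: mult_2)
  also have "\<dots> = (\<Sum>j\<in>{-int n..int n}.
      theta_term y q (int n + j) * qbinomial q (2 * n) (nat (int n + j)))"
    by (rule sum.reindex_bij_witness[of _ "\<lambda>j. nat (int n + j)" "\<lambda>k. int k - int n"]) auto
  also have "\<dots> = c * (\<Sum>j\<in>{-int n..int n}.
      theta_term x q j * qbinomial q (2 * n) (nat (int n + j)))"
    using y by (simp add: theta_term_add[OF assms(1)] c_def sum_distrib_left mult.assoc)
  finally show ?thesis using \<open>c \<noteq> 0\<close> by simp
qed

definition theta_sum :: "'a :: {real_normed_field, banach} \<Rightarrow> 'a \<Rightarrow> 'a" where
  "theta_sum x q = (\<Sum>\<^sub>\<infinity>j. theta_term x q j)"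

lemma summable_theta_term_of_nat:
  fixes x q :: "'a :: real_normed_field"
  assumes "norm q < 1"
  shows "summable (\<lambda>k. norm (theta_term x q (int k)))"
proof -
  have "(\<lambda>k. norm (x * q ^ k)) \<longlonglongrightarrow> 0"
    using tendsto_mult[OF tendsto_const LIMSEQ_power_zero[OF assms], of x]
    by (intro tendsto_norm_zero) simp
  then have "eventually (\<lambda>k. norm (x * q ^ k) < 1 / 2) sequentially"
    by (rule order_tendstoD) simp
  then obtain N where norm_less_half: "\<And>k. k \<ge> N \<Longrightarrow> norm (x * q ^ k) < 1 / 2"
    by (auto simp: eventually_sequentially)
  show ?thesis
  proof (rule summable_ratio_test[of "1/2" N])
    fix k assume "k \<ge> N"
    have "norm (theta_term x q (int (Suc k))) = norm (x * q ^ k) * norm (theta_term x q (int k))"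
      unfolding theta_term_of_nat by (simp add: numeral_2_eq_2 power_add norm_mult)
    also have "\<dots> \<le> 1 / 2 * norm (theta_term x q (int k))"
      using norm_less_half[OF \<open>k \<ge> N\<close>] by (intro mult_right_mono) auto
    finally show "norm (norm (theta_term x q (int (Suc k)))) \<le>
        1 / 2 * norm (norm (theta_term x q (int k)))"
      by simp
  qed simp
qed

lemma summable_on_norm_theta_term:
  fixes x q :: "'a :: real_normed_field"
  assumes "norm q < 1" "q \<noteq> 0"
  shows "(\<lambda>j. norm (theta_term x q j)) summable_on UNIV"
proof -
  let ?f = "\<lambda>x j. norm (theta_term x q j)"
  have of_nat: "?f x \<circ> int summable_on UNIV" for x
    using summable_theta_term_of_nat[OF assms(1), of x]
    by (simp add: summable_on_UNIV_nonneg_real_iff o_def)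
  have "?f x summable_on range int"
    using of_nat by (simp add: summable_on_reindex)
  moreover have "?f x summable_on range (\<lambda>k. - int k)"
    using of_nat[of "q / x"]
    by (simp add: summable_on_reindex inj_on_def o_def theta_term_uminus[OF assms(2)])
  ultimately have "?f x summable_on (range int \<union> range (\<lambda>k. - int k))"
    by (rule summable_on_union)
  moreover have "range int \<union> range (\<lambda>k. - int k) = UNIV"
    by (auto simp: image_iff) (metis int_cases2)
  ultimately show ?thesis by simp
qed

lemma has_sum_theta_sum:
  assumes "norm q < 1" "q \<noteq> 0"
  shows "(theta_term x q has_sum theta_sum x q) UNIV"
  using Infinite_Sum.abs_summable_summable[OF summable_on_norm_theta_term[OF assms]]
  unfolding theta_sum_def by (rule has_sum_infsum)

lemma infsum_dominated_convergence:
  fixes f :: "'b \<Rightarrow> 'a \<Rightarrow> 'c :: banach"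
  assumes lim: "\<And>j. j \<in> A \<Longrightarrow> ((\<lambda>n. f n j) \<longlongrightarrow> g j) F"
    and bound: "\<And>n j. j \<in> A \<Longrightarrow> norm (f n j) \<le> h j" and h: "h summable_on A" and "F \<noteq> bot"
  shows "((\<lambda>n. infsum (f n) A) \<longlongrightarrow> infsum g A) F"
proof (rule swap_uniform_limit')
  show "uniform_limit UNIV (\<lambda>J n. \<Sum>j\<in>J. f n j) (\<lambda>n. infsum (f n) A) (finite_subsets_at_top A)"
    using bound h by (intro Weierstrass_m_test_general) auto
  show "eventually (\<lambda>J. ((\<lambda>n. \<Sum>j\<in>J. f n j) \<longlongrightarrow> (\<Sum>j\<in>J. g j)) F) (finite_subsets_at_top A)"
    by (auto intro!: eventually_finite_subsets_at_top_weakI tendsto_sum lim)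
  have "norm (g j) \<le> h j" if "j \<in> A" for j
    using tendsto_upperbound[OF tendsto_norm[OF lim[OF that]]] bound[OF that] \<open>F \<noteq> bot\<close> by simp
  then have "g summable_on A"
    using Infinite_Sum.abs_summable_on_comparison_test'[OF h] Infinite_Sum.abs_summable_summable
    by blast
  then show "((\<lambda>J. \<Sum>j\<in>J. g j) \<longlongrightarrow> infsum g A) (finite_subsets_at_top A)"
    by (simp add: infsum_tendsto)
qed auto

lemma tendsto_sum_theta_term_qbinomial:
  fixes x q :: "'a :: {real_normed_field, banach}"
  assumes q: "norm q < 1" "q \<noteq> 0"
  shows "(\<lambda>n. \<Sum>j\<in>{-int n..int n}. theta_term x q j * qbinomial q (2 * n) (nat (int n + j)))
    \<longlonglongrightarrow> theta_sum x q * inverse (qpochhammer_inf q q)"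
proof -
  let ?E = "qpochhammer_inf q q"
  define f where "f n j = (if j \<in> {-int n..int n}
    then theta_term x q j * qbinomial q (2 * n) (nat (int n + j)) else 0)" for n j
  obtain C where norm_le_C: "\<And>n k. norm (qbinomial q n k) \<le> C"
    using bounded_qbinomial[OF q(1)] by blast
  have "(\<lambda>n. infsum (f n) UNIV) \<longlonglongrightarrow> (\<Sum>\<^sub>\<infinity>j. theta_term x q j * inverse ?E)"
  proof (rule infsum_dominated_convergence[where h = "\<lambda>j. norm (theta_term x q j) * C"])
    fix j
    have "(\<lambda>n. theta_term x q j * qbinomial q (2 * n) (nat (int n + j)))
        \<longlonglongrightarrow> theta_term x q j * inverse ?E"
      by (intro tendsto_intros tendsto_central_qbinomial q)
    moreover have "eventually (\<lambda>n. theta_term x q j * qbinomial q (2 * n) (nat (int n + j)) = f n j)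
        sequentially"
      using eventually_ge_at_top[of "nat \<bar>j\<bar>"] by eventually_elim (auto simp: f_def)
    ultimately show "(\<lambda>n. f n j) \<longlonglongrightarrow> theta_term x q j * inverse ?E"
      by (rule Lim_transform_eventually)
  next
    fix n j
    have "0 \<le> C" using norm_le_C norm_ge_zero order_trans by blast
    then show "norm (f n j) \<le> norm (theta_term x q j) * C"
      by (auto simp: f_def norm_mult intro!: mult_left_mono norm_le_C)
  next
    show "(\<lambda>j. norm (theta_term x q j) * C) summable_on UNIV"
      by (intro summable_on_cmult_left summable_on_norm_theta_term q)
  qed simp
  moreover have "infsum (f n) UNIV = (\<Sum>\<^sub>\<infinity>j\<in>{-int n..int n}.
      theta_term x q j * qbinomial q (2 * n) (nat (int n + j)))" for n
    by (rule infsum_cong_neutral) (auto simp: f_def)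
  ultimately show ?thesis by (simp add: infsum_cmult_left' theta_sum_def)
qed

theorem jacobi_triple_product:
  fixes x q :: "'a :: {real_normed_field, banach}"
  assumes q: "norm q < 1" "q \<noteq> 0" and "x \<noteq> 0"
  shows "qpochhammer_inf q q * qtheta (- x) q = theta_sum x q"
proof -
  have "(\<lambda>n. qpochhammer n (- x) q * qpochhammer n (q / - x) q) \<longlonglongrightarrow> qtheta (- x) q"
    unfolding qtheta_def by (intro tendsto_mult qpochhammer_LIMSEQ q)
  moreover have "(\<lambda>n. qpochhammer n (- x) q * qpochhammer n (q / - x) q)
      \<longlonglongrightarrow> theta_sum x q * inverse (qpochhammer_inf q q)"
    using tendsto_sum_theta_term_qbinomial[OF q, of x]
    by (simp add: finite_jacobi_triple_product \<open>q \<noteq> 0\<close> \<open>x \<noteq> 0\<close>)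
  ultimately have "qtheta (- x) q = theta_sum x q * inverse (qpochhammer_inf q q)"
    by (rule LIMSEQ_unique)
  then show ?thesis
    using qpochhammer_inf_nonzero[OF q(1) q(1)] by simp
qed

section \<open>The three-term relation\<close>

lemma theta_term_mult_left: "theta_term (c * x) q j = c powi j * theta_term x q j"
  by (simp add: theta_term_def power_int_mult_distrib)

lemma theta_term_mult_even:
  fixes q x y :: "'a :: field"
  assumes "q \<noteq> 0" "x \<noteq> 0" "y \<noteq> 0"
  shows "theta_term (- (x * y)) q (r + s) * theta_term (- (x / y)) q (r - s) =
    theta_term (x\<^sup>2) (q\<^sup>2) r * theta_term (q * y\<^sup>2) (q\<^sup>2) s"
proof -
  let ?tri = "\<lambda>j :: int. j * (j - 1) div 2"
  have double: "2 * ?tri j = j * (j - 1)" for j by simp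
  have "2 * (?tri (r + s) + ?tri (r - s)) = 2 * (2 * ?tri r + 2 * ?tri s + s)"
    unfolding distrib_left double by (simp add: algebra_simps)
  then have "?tri (r + s) + ?tri (r - s) = 2 * ?tri r + 2 * ?tri s + s"
    by (simp only: mult_left_cancel[OF zero_neq_numeral[symmetric]])
  then have nome: "q powi ?tri (r + s) * q powi ?tri (r - s) =
      (q\<^sup>2) powi ?tri r * ((q\<^sup>2) powi ?tri s * q powi s)"
    using assms by (simp add: power_int_power power_int_add[symmetric] add.assoc)
  have "a powi (r + s) * b powi (r - s) = (a * b) powi r * (a / b) powi s"
    if "a \<noteq> 0" "b \<noteq> 0" for a b :: 'a
    using that
    by (simp add: power_int_add power_int_diff power_int_mult_distrib power_int_divide_distrib)
  from this[of "- (x * y)" "- (x / y)"]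
  have base: "(- (x * y)) powi (r + s) * (- (x / y)) powi (r - s) = (x\<^sup>2) powi r * (y\<^sup>2) powi s"
    using assms by (simp add: power2_eq_square)
  have "theta_term (- (x * y)) q (r + s) * theta_term (- (x / y)) q (r - s) =
      (q powi ?tri (r + s) * q powi ?tri (r - s)) *
      ((- (x * y)) powi (r + s) * (- (x / y)) powi (r - s))"
    by (simp only: theta_term_def mult_ac)
  also have "\<dots> = theta_term (x\<^sup>2) (q\<^sup>2) r * theta_term (q * y\<^sup>2) (q\<^sup>2) s"
    unfolding nome base theta_term_def by (simp only: power_int_mult_distrib mult_ac)
  finally show ?thesis .
qed

lemma theta_term_mult_odd:
  assumes "q \<noteq> 0" "x \<noteq> 0" "y \<noteq> 0"
  shows "theta_term (- (x * y)) q (r + s) * theta_term (- (x / y)) q (r - s + 1) =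
    - (x / y) * (theta_term (q * x\<^sup>2) (q\<^sup>2) r * theta_term (y\<^sup>2) (q\<^sup>2) s)"
proof -
  have "theta_term z q 1 = z" for z by (simp add: theta_term_def)
  then have "theta_term (- (x / y)) q (r - s + 1) =
      - (x / y) * q powi (r - s) * theta_term (- (x / y)) q (r - s)"
    using theta_term_add[of q "- (x / y)" "r - s" 1] assms by simp
  then have "theta_term (- (x * y)) q (r + s) * theta_term (- (x / y)) q (r - s + 1) =
      - (x / y) * q powi (r - s) *
      (theta_term (- (x * y)) q (r + s) * theta_term (- (x / y)) q (r - s))"
    by simp
  also have "\<dots> = - (x / y) * ((q powi r * theta_term (x\<^sup>2) (q\<^sup>2) r) *
      (theta_term (q * y\<^sup>2) (q\<^sup>2) s / q powi s))"
    unfolding theta_term_mult_even[OF assms] using assms(1) by (simp add: power_int_diff)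
  finally show ?thesis using assms(1) by (simp add: theta_term_mult_left)
qed

lemma has_sum_mult_Times:
  fixes f :: "'a \<Rightarrow> 'c :: {real_normed_field, banach}"
  assumes f: "(f has_sum a) A" "(\<lambda>i. norm (f i)) summable_on A"
    and g: "(g has_sum b) B" "(\<lambda>j. norm (g j)) summable_on B"
  shows "((\<lambda>(i, j). f i * g j) has_sum a * b) (A \<times> B)"
proof (rule has_sum_SigmaI)
  show "((\<lambda>j. case (i, j) of (i, j) \<Rightarrow> f i * g j) has_sum f i * b) B" for i
    using has_sum_cmult_right[OF g(1), of "f i"] by simp
  show "((\<lambda>i. f i * b) has_sum a * b) A"
    by (rule has_sum_cmult_left[OF f(1)])
  have "(\<lambda>j. norm (f i * g j)) summable_on B" for i
    using summable_on_cmult_right[OF g(2), of "norm (f i)"] by (simp only: norm_mult)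
  moreover have "(\<lambda>i. norm (\<Sum>\<^sub>\<infinity>j\<in>B. norm (f i * g j))) summable_on A"
    using summable_on_cmult_left[OF f(2), of "norm (\<Sum>\<^sub>\<infinity>j\<in>B. norm (g j))"]
    by (simp only: norm_mult infsum_cmult_right' real_norm_def abs_norm_cancel abs_mult)
  ultimately have "Infinite_Sum.abs_summable_on (\<lambda>(i, j). f i * g j) (A \<times> B)"
    unfolding Infinite_Sum.abs_summable_on_Sigma_iff prod.case by blast
  then show "(\<lambda>(i, j). f i * g j) summable_on A \<times> B"
    by (rule Infinite_Sum.abs_summable_summable)
qed

lemma has_sum_even_odd_pairs:
  fixes f :: "int \<times> int \<Rightarrow> 'a :: topological_comm_monoid_add"
  assumes even: "((\<lambda>(r, s). f (r + s, r - s)) has_sum a) UNIV"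
    and odd: "((\<lambda>(r, s). f (r + s, r - s + 1)) has_sum b) UNIV"
  shows "(f has_sum (a + b)) UNIV"
proof -
  let ?half = "\<lambda>(m, n). ((m + n) div 2, m - (m + n) div 2)"
  have "(f has_sum a) {(m, n). even (m + n)}"
    using even
    by (subst (asm) has_sum_reindex_bij_witness[where
          j = "\<lambda>(r, s). (r + s, r - s)" and i = ?half and h = f]) auto
  moreover have "(f has_sum b) {(m, n). odd (m + n)}"
    using odd
    by (subst (asm) has_sum_reindex_bij_witness[where
          j = "\<lambda>(r, s). (r + s, r - s + 1)" and i = ?half and h = f]) (auto, presburger+)
  ultimately have "(f has_sum (a + b)) ({(m, n). even (m + n)} \<union> {(m, n). odd (m + n)})"
    by (rule has_sum_Un_disjoint) auto
  moreover have "{(m, n). even (m + n)} \<union> {(m, n). odd (m + n)} = (UNIV :: (int \<times> int) set)"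
    by auto
  ultimately show ?thesis by simp
qed

lemma has_sum_theta_term_mult:
  assumes "norm p < 1" "p \<noteq> 0"
  shows "((\<lambda>(i, j). theta_term x p i * theta_term y p j) has_sum
    theta_sum x p * theta_sum y p) UNIV"
  using has_sum_mult_Times[OF has_sum_theta_sum summable_on_norm_theta_term has_sum_theta_sum
      summable_on_norm_theta_term] assms by (simp flip: UNIV_Times_UNIV)

lemma theta_sum_mult:
  assumes q: "norm q < 1" "q \<noteq> 0" and "x \<noteq> 0" "y \<noteq> 0"
  shows "theta_sum (- (x * y)) q * theta_sum (- (x / y)) q =
    theta_sum (x\<^sup>2) (q\<^sup>2) * theta_sum (q * y\<^sup>2) (q\<^sup>2)
    - x / y * (theta_sum (q * x\<^sup>2) (q\<^sup>2) * theta_sum (y\<^sup>2) (q\<^sup>2))"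
    (is "_ = ?even - _ * ?odd")
proof -
  let ?f = "\<lambda>(m, n). theta_term (- (x * y)) q m * theta_term (- (x / y)) q n"
  have q2: "norm (q\<^sup>2) < 1" "q\<^sup>2 \<noteq> 0" using q norm_power_less_one[of q 2] by simp_all
  have "((\<lambda>(r, s). ?f (r + s, r - s)) has_sum ?even) UNIV"
    using has_sum_theta_term_mult[OF q2] assms by (simp add: theta_term_mult_even)
  moreover have "((\<lambda>(r, s). ?f (r + s, r - s + 1)) has_sum (- (x / y) * ?odd)) UNIV"
    using has_sum_cmult_right[OF has_sum_theta_term_mult[OF q2], of "- (x / y)"] assms
    by (simp only: theta_term_mult_odd[OF assms(2-4)] case_prod_unfold fst_conv snd_conv)
  ultimately have "(?f has_sum (?even + - (x / y) * ?odd)) UNIV"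
    by (rule has_sum_even_odd_pairs)
  then show ?thesis
    using has_sum_unique[OF has_sum_theta_term_mult[OF q]] by simp
qed

definition qtheta_pair :: "'a :: {real_normed_field, banach} \<Rightarrow> 'a \<Rightarrow> 'a \<Rightarrow> 'a" where
  "qtheta_pair x y q = qtheta (x * y) q * qtheta (x / y) q"

lemma qtheta_pair_eq_minor:
  assumes q: "norm q < 1" "q \<noteq> 0" and xy: "x \<noteq> 0" "y \<noteq> 0"
  shows "y * qtheta_pair x y q * (qpochhammer_inf q q)\<^sup>2 =
    theta_sum (x\<^sup>2) (q\<^sup>2) * (y * theta_sum (q * y\<^sup>2) (q\<^sup>2)) -
    (x * theta_sum (q * x\<^sup>2) (q\<^sup>2)) * theta_sum (y\<^sup>2) (q\<^sup>2)"
proof -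
  have "qtheta_pair x y q * (qpochhammer_inf q q)\<^sup>2 =
      (qpochhammer_inf q q * qtheta (x * y) q) * (qpochhammer_inf q q * qtheta (x / y) q)"
    by (simp add: qtheta_pair_def power2_eq_square mult_ac)
  also have "\<dots> = theta_sum (- (x * y)) q * theta_sum (- (x / y)) q"
    using jacobi_triple_product[OF q, of "- (x * y)"] jacobi_triple_product[OF q, of "- (x / y)"] xy
    by simp
  finally show ?thesis
    using xy unfolding theta_sum_mult[OF q xy] by (simp add: right_diff_distrib mult_ac)
qed

theorem weierstrass_three_term:
  assumes q: "norm q < 1" "q \<noteq> 0" and nz: "x \<noteq> 0" "y \<noteq> 0" "u \<noteq> 0" "v \<noteq> 0"
  shows "y * (qtheta_pair x y q * qtheta_pair u v q) - u * (qtheta_pair x u q * qtheta_pair y v q)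
    + u * (qtheta_pair x v q * qtheta_pair y u q) = 0" (is "?relation = 0")
proof -
  define E where "E = (qpochhammer_inf q q)\<^sup>2"
  define A where "A z = theta_sum (z\<^sup>2) (q\<^sup>2)" for z
  define B where "B z = z * theta_sum (q * z\<^sup>2) (q\<^sup>2)" for z
  have minor: "w * qtheta_pair z w q * E = A z * B w - B z * A w" if "z \<noteq> 0" "w \<noteq> 0" for z w
    unfolding A_def B_def E_def by (rule qtheta_pair_eq_minor[OF q that])
  have "v * E * E * ?relation =
      (y * qtheta_pair x y q * E) * (v * qtheta_pair u v q * E) -
      (u * qtheta_pair x u q * E) * (v * qtheta_pair y v q * E) +
      (v * qtheta_pair x v q * E) * (u * qtheta_pair y u q * E)"
    by (simp add: algebra_simps)
  also have "\<dots> = (A x * B y - B x * A y) * (A u * B v - B u * A v) -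
      (A x * B u - B x * A u) * (A y * B v - B y * A v) +
      (A x * B v - B x * A v) * (A y * B u - B y * A u)"
    by (simp only: minor nz not_False_eq_True)
  also have "\<dots> = 0" by (simp add: algebra_simps)
  finally show ?thesis
    using nz qpochhammer_inf_nonzero[OF q(1) q(1)] by (simp add: E_def)
qed

lemma qtheta_pair_mult_sign:
  assumes "t * t = 1"
  shows "qtheta_pair x (t * y) q = qtheta_pair (t * x) y q"
proof -
  have "t \<noteq> 0" using assms by auto
  then have "t * x / y = t * t * x / (t * y)" by simp
  then show ?thesis using assms by (simp add: qtheta_pair_def mult_ac)
qed

lemma qtheta_pair_minus: "qtheta_pair x (- y) q = qtheta_pair (- x) y q"
  by (simp add: qtheta_pair_def)

lemma weierstrass_three_term_signs:
  fixes q x y u v e :: "'a :: {real_normed_field, banach}"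
  assumes q: "norm q < 1" "q \<noteq> 0" and nz: "x \<noteq> 0" "y \<noteq> 0" "u \<noteq> 0" "v \<noteq> 0" and e: "e * e = 1"
  shows "u * (e * (qtheta_pair (- e * x) v q * qtheta_pair (- e * y) u q -
      qtheta_pair (e * x) u q * qtheta_pair (e * y) v q)) =
    y * (qtheta_pair (- x) y q * qtheta_pair (- u) v q)"
proof -
  have "e \<noteq> 0" and square: "e * (e * z) = z" for z
    using e by (auto simp flip: mult.assoc)
  then have "- y * (qtheta_pair x (- y) q * qtheta_pair (e * u) (- (e * v)) q) -
      e * u * (qtheta_pair x (e * u) q * qtheta_pair (- y) (- (e * v)) q) +
      e * u * (qtheta_pair x (- (e * v)) q * qtheta_pair (- y) (e * u) q) = 0"
    using nz by (intro weierstrass_three_term q) simp_all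
  then have "- y * (qtheta_pair (- x) y q * qtheta_pair (- u) v q) -
      e * u * (qtheta_pair (e * x) u q * qtheta_pair (e * y) v q) +
      e * u * (qtheta_pair (- (e * x)) v q * qtheta_pair (- (e * y)) u q) = 0"
    by (simp add: qtheta_pair_minus qtheta_pair_mult_sign[OF e] square)
  then show ?thesis
    by (simp add: algebra_simps)
qed

section \<open>Theta functions of powers of the nome\<close>

lemma prodinf_residue_classes:
  fixes f :: "nat \<Rightarrow> 'a :: {real_normed_field, banach}"
  assumes "0 < M" "convergent_prod f" "\<And>i. i < M \<Longrightarrow> convergent_prod (\<lambda>k. f (k * M + i))"
  shows "(\<Prod>m. f m) = (\<Prod>i<M. \<Prod>k. f (k * M + i))"
proof (rule LIMSEQ_unique)
  have "(\<lambda>n. \<Prod>m<n. f m) \<longlonglongrightarrow> (\<Prod>m. f m)"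
    by (intro has_prod_imp_tendsto' convergent_prod_has_prod assms(2))
  from filterlim_compose[OF this mult_nat_left_at_top[OF assms(1)]]
  show "(\<lambda>N. \<Prod>m<M * N. f m) \<longlonglongrightarrow> (\<Prod>m. f m)" .
  have "(\<Prod>m<M * N. f m) = (\<Prod>i<M. \<Prod>k<N. f (k * M + i))" for N
  proof -
    have "(\<Prod>m<M * N. f m) = (\<Prod>k<N. \<Prod>m\<in>{k * M..<k * M + M}. f m)"
      by (simp add: prod.nat_group mult.commute)
    also have "\<dots> = (\<Prod>k<N. \<Prod>i<M. f (k * M + i))"
      by (simp add: prod.atLeastLessThan_shift_0 atLeast0LessThan)
    also have "\<dots> = (\<Prod>i<M. \<Prod>k<N. f (k * M + i))"
      by (rule prod.swap)
    finally show ?thesis .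
  qed
  moreover have "(\<lambda>N. \<Prod>i<M. \<Prod>k<N. f (k * M + i)) \<longlonglongrightarrow> (\<Prod>i<M. \<Prod>k. f (k * M + i))"
    by (intro tendsto_prod has_prod_imp_tendsto' convergent_prod_has_prod assms(3)) simp
  ultimately show "(\<lambda>N. \<Prod>m<M * N. f m) \<longlonglongrightarrow> (\<Prod>i<M. \<Prod>k. f (k * M + i))"
    by simp
qed

lemma qpochhammer_inf_dissect:
  assumes "norm q < 1" "0 < M"
  shows "qpochhammer_inf a q = (\<Prod>i<M. qpochhammer_inf (a * q ^ i) (q ^ M))"
proof -
  have term_eq: "1 - a * q ^ (k * M + i) = 1 - a * q ^ i * (q ^ M) ^ k" for k i
    by (simp add: power_add power_mult[symmetric] mult.commute)
  have "(\<Prod>k. 1 - a * q ^ k) = (\<Prod>i<M. \<Prod>k. 1 - a * q ^ (k * M + i))"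
  proof (rule prodinf_residue_classes[OF assms(2) convergent_prod_qpochhammer[OF assms(1)]])
    show "convergent_prod (\<lambda>k. 1 - a * q ^ (k * M + i))" for i
      unfolding term_eq by (rule convergent_prod_qpochhammer[OF norm_power_less_one[OF assms]])
  qed
  then show ?thesis by (simp only: qpochhammer_inf_def term_eq)
qed

lemma qpochhammer_inf_mult_minus:
  assumes "norm q < 1"
  shows "qpochhammer_inf a q * qpochhammer_inf (- a) q = qpochhammer_inf (a\<^sup>2) (q\<^sup>2)"
proof -
  have "qpochhammer_inf a q * qpochhammer_inf (- a) q = (\<Prod>k. (1 - a * q ^ k) * (1 - (- a) * q ^ k))"
    unfolding qpochhammer_inf_def by (intro prodinf_mult convergent_prod_qpochhammer assms)
  also have "(\<lambda>k. (1 - a * q ^ k) * (1 - (- a) * q ^ k)) = (\<lambda>k. 1 - a\<^sup>2 * (q\<^sup>2) ^ k)"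
    by (auto simp: algebra_simps power2_eq_square power_mult_distrib)
  finally show ?thesis by (simp add: qpochhammer_inf_def)
qed

lemma qtheta_mult_minus:
  assumes "norm q < 1"
  shows "qtheta x q * qtheta (- x) q = qtheta (x\<^sup>2) (q\<^sup>2)"
  using qpochhammer_inf_mult_minus[OF assms, of x] qpochhammer_inf_mult_minus[OF assms, of "q / x"]
  by (simp add: qtheta_def power_divide mult_ac)

lemma qtheta_power:
  assumes "q \<noteq> 0" "n \<le> M"
  shows "qtheta (q ^ n) (q ^ M) =
    qpochhammer_inf (q ^ n) (q ^ M) * qpochhammer_inf (q ^ (M - n)) (q ^ M)"
  using assms by (simp add: qtheta_def power_diff)

lemma qtheta_power_reflect:
  assumes "q \<noteq> 0" "n \<le> M"
  shows "qtheta (q ^ (M - n)) (q ^ M) = qtheta (q ^ n) (q ^ M)"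
  using assms by (simp add: qtheta_power)

lemma qtheta_power_nonzero:
  assumes "norm q < 1" "q \<noteq> 0" "0 < n" "n < M"
  shows "qtheta (q ^ n) (q ^ M) \<noteq> 0"
  using assms by (simp add: qtheta_power qpochhammer_inf_nonzero norm_power_less_one)

lemma qtheta_power_dissect:
  assumes "norm q < 1" "q \<noteq> 0" "n < M"
  shows "qtheta (q ^ n) (q ^ M) = qtheta (q ^ n) (q ^ (2 * M)) * qtheta (q ^ (M - n)) (q ^ (2 * M))"
proof -
  have dissect: "qpochhammer_inf (q ^ i) (q ^ M) =
      qpochhammer_inf (q ^ i) (q ^ (2 * M)) * qpochhammer_inf (q ^ (M + i)) (q ^ (2 * M))" for i
    using qpochhammer_inf_dissect[OF norm_power_less_one[OF assms(1)], of M 2 "q ^ i"] assms(3)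
    by (simp add: numeral_2_eq_2 power_add power_mult[symmetric] mult_ac)
  have "M + (M - n) = 2 * M - n" "M + n = 2 * M - (M - n)" using assms(3) by simp_all
  then show ?thesis
    using assms by (simp add: qtheta_power dissect mult_ac)
qed

lemma qtheta_minus_power:
  assumes "norm q < 1" "q \<noteq> 0" "0 < n" "n < M"
  shows "qtheta (- (q ^ n)) (q ^ M) = qtheta (q ^ (2 * n)) (q ^ (2 * M)) /
    (qtheta (q ^ n) (q ^ (2 * M)) * qtheta (q ^ (M - n)) (q ^ (2 * M)))"
proof -
  have "qtheta (q ^ n) (q ^ M) * qtheta (- (q ^ n)) (q ^ M) = qtheta (q ^ (2 * n)) (q ^ (2 * M))"
    using qtheta_mult_minus[OF norm_power_less_one[OF assms(1)], of M "q ^ n"] assms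
    by (simp add: mult.commute flip: power_mult)
  then show ?thesis
    using qtheta_power_nonzero[OF assms] qtheta_power_dissect[OF assms(1,2,4)]
    by (simp add: eq_divide_eq mult.commute)
qed

lemma qtheta_pair_powers:
  assumes "q \<noteq> 0" "n \<le> m"
  shows "qtheta_pair (q ^ m) (q ^ n) p = qtheta (q ^ (m + n)) p * qtheta (q ^ (m - n)) p"
    and "qtheta_pair (- (q ^ m)) (q ^ n) p =
      qtheta (- (q ^ (m + n))) p * qtheta (- (q ^ (m - n))) p"
  using assms by (simp_all add: qtheta_pair_def power_add power_diff)

lemma weierstrass_three_term_powers:
  fixes q e :: "'a :: {real_normed_field, banach}"
  assumes q: "norm q < 1" "q \<noteq> 0" and "0 < M" and e: "e * e = 1" and "c \<le> b"
  defines "P \<equiv> \<lambda>s m n. qtheta_pair (s * q ^ m) (q ^ n) (q ^ M)"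
  shows "e * (P (- e) a d * P (- e) b c - P e a c * P e b d) =
    q ^ (b - c) * (P (- 1) a b * P (- 1) c d)"
proof -
  have "q ^ c * (e * (P (- e) a d * P (- e) b c - P e a c * P e b d)) =
      q ^ b * (P (- 1) a b * P (- 1) c d)"
    using weierstrass_three_term_signs[of "q ^ M" "q ^ a" "q ^ b" "q ^ c" "q ^ d" e]
      q e norm_power_less_one[OF q(1) \<open>0 < M\<close>] by (simp add: P_def)
  moreover have "q ^ b = q ^ c * q ^ (b - c)"
    using \<open>c \<le> b\<close> by (simp flip: power_add)
  ultimately have "q ^ c * (e * (P (- e) a d * P (- e) b c - P e a c * P e b d)) =
      q ^ c * (q ^ (b - c) * (P (- 1) a b * P (- 1) c d))"
    by (simp only: mult.assoc)
  then show ?thesis using q(2) by simp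
qed

section \<open>Partitions into parts from residue classes\<close>

lemma pm_residues_eq:
  assumes "R \<subseteq> {0<..<M}"
  shows "pm_residues (int ` R) (int M) = {n. n mod M \<in> R \<union> (\<lambda>r. M - r) ` R}"
proof -
  have plus: "[int n = int r] (mod int M) \<longleftrightarrow> n mod M = r" if "r < M" for n r
    using that by (simp only: cong_int_iff) (simp add: Cong.cong_def)
  have minus: "[int n = - int r] (mod int M) \<longleftrightarrow> n mod M = M - r" if "0 < r" "r < M" for n r
  proof -
    have "[- int r = int (M - r)] (mod int M)"
      using that by (simp add: cong_iff_dvd_diff of_nat_diff)
    then have "[int n = - int r] (mod int M) \<longleftrightarrow> [int n = int (M - r)] (mod int M)"
      by (meson cong_sym cong_trans)
    then show ?thesis using that by (simp only: plus)
  qed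
  have "[int n = int r] (mod int M) \<or> [int n = - int r] (mod int M) \<longleftrightarrow> n mod M = r \<or> n mod M = M - r"
    if "r \<in> R" for n r
  proof -
    have "0 < r" "r < M" using assms that by auto
    then show ?thesis using plus minus by simp
  qed
  then have "pm_residues (int ` R) (int M) = {n. n > 0 \<and> (\<exists>r\<in>R. n mod M = r \<or> n mod M = M - r)}"
    by (simp add: pm_residues_def cong: bex_cong)
  also have "n > 0" if "r \<in> R" "n mod M = r \<or> n mod M = M - r" for n r
    using that assms by (cases "n = 0") auto
  then have "{n. n > 0 \<and> (\<exists>r\<in>R. n mod M = r \<or> n mod M = M - r)} =
      {n. n mod M \<in> R \<union> (\<lambda>r. M - r) ` R}"
    by blast
  finally show ?thesis .
qed

lemma euler_product_residues:
  assumes "norm q < 1" "0 < M" "I \<subseteq> {..<M}"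
  shows "euler_product {m. m mod M \<in> I} q = (\<Prod>i\<in>I. qpochhammer_inf (q ^ i) (q ^ M))"
proof -
  define f where "f m = (if m mod M \<in> I then 1 - q ^ m else 1)" for m
  have term_eq: "f (k * M + i) = (if i \<in> I then 1 - q ^ i * (q ^ M) ^ k else 1)" if "i < M" for k i
    using that by (simp add: f_def power_add mult.commute flip: power_mult)
  have "convergent_prod (\<lambda>k. f (k * M + i))" if "i < M" for i
    using convergent_prod_qpochhammer[OF norm_power_less_one[OF assms(1,2)]]
    by (cases "i \<in> I") (simp_all add: term_eq that)
  moreover have "convergent_prod f"
    using convergent_prod_euler_product[OF assms(1), of "{m. m mod M \<in> I}"]
    by (simp add: f_def[abs_def])
  ultimately have "prodinf f = (\<Prod>i<M. \<Prod>k. f (k * M + i))"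
    by (intro prodinf_residue_classes assms(2))
  also have "\<dots> = (\<Prod>i<M. if i \<in> I then qpochhammer_inf (q ^ i) (q ^ M) else 1)"
    by (intro prod.cong) (auto simp: term_eq qpochhammer_inf_def)
  also have "\<dots> = (\<Prod>i\<in>I. qpochhammer_inf (q ^ i) (q ^ M))"
    using assms(3) by (simp add: prod.inter_restrict[symmetric] Int_absorb1)
  finally show ?thesis by (simp add: euler_product_def f_def[abs_def])
qed

definition qtheta_prod :: "nat set \<Rightarrow> nat \<Rightarrow> 'a :: {real_normed_field, banach} \<Rightarrow> 'a" where
  "qtheta_prod R M q = (\<Prod>r\<in>R. qtheta (q ^ r) (q ^ M))"

theorem sums_num_partitions_pm_residues:
  fixes q :: "'a :: {real_normed_field, banach}"
  assumes q: "norm q < 1" "q \<noteq> 0" and M: "0 < M" and R: "\<forall>r\<in>R. 0 < r \<and> 2 * r < M"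
  shows "(\<lambda>n. of_nat (num_partitions (pm_residues (int ` R) (int M)) n) * q ^ n) sums
    inverse (qtheta_prod R M q)"
proof -
  let ?R' = "(\<lambda>r. M - r) ` R"
  have bounded: "R \<subseteq> {0<..<M}" using R by force
  then have "finite R" by (rule finite_subset) simp
  have "inj_on (\<lambda>r. M - r) R" using R by (force simp: inj_on_def)
  moreover have "r \<noteq> M - s" if "r \<in> R" "s \<in> R" for r s
    using R[rule_format, OF that(1)] R[rule_format, OF that(2)] by linarith
  then have "R \<inter> ?R' = {}" by blast
  ultimately have "(\<Prod>i\<in>R \<union> ?R'. qpochhammer_inf (q ^ i) (q ^ M)) =
      (\<Prod>r\<in>R. qpochhammer_inf (q ^ r) (q ^ M) * qpochhammer_inf (q ^ (M - r)) (q ^ M))"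
    using \<open>finite R\<close> by (simp add: prod.union_disjoint prod.reindex prod.distrib)
  also have "\<dots> = qtheta_prod R M q"
    unfolding qtheta_prod_def using bounded q(2)
    by (intro prod.cong refl qtheta_power[symmetric]) auto
  finally have "euler_product (pm_residues (int ` R) (int M)) q = qtheta_prod R M q"
    using bounded M
    by (subst pm_residues_eq[OF bounded], subst euler_product_residues[OF q(1) M]) auto
  moreover have "0 \<notin> pm_residues (int ` R) (int M)" by (simp add: pm_residues_def)
  ultimately show ?thesis using sums_num_partitions q(1) by metis
qed

lemma num_partitions_pm_residues_shift:
  assumes R: "\<forall>r\<in>R. 0 < r \<and> 2 * r < M" and T: "\<forall>r\<in>T. 0 < r \<and> 2 * r < M"
    and M: "0 < M"
    and eq: "\<And>q :: real. norm q < 1 \<Longrightarrow> q \<noteq> 0 \<Longrightarrow>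
      inverse (qtheta_prod R M q) - q ^ e * inverse (qtheta_prod T M q) = 1"
    and e: "0 < e" "e \<le> n"
  shows "num_partitions (pm_residues (int ` R) (int M)) n =
    num_partitions (pm_residues (int ` T) (int M)) (n - e)"
proof -
  have "real (num_partitions (pm_residues (int ` R) (int M)) n) =
      real (num_partitions (pm_residues (int ` T) (int M)) (n - e))"
  proof (rule powser_coeff_shift[OF _ _ _ zero_less_one e])
    fix q :: real assume q: "q \<noteq> 0" "norm q < 1"
    show "(\<lambda>n. real (num_partitions (pm_residues (int ` R) (int M)) n) * q ^ n) sums
        inverse (qtheta_prod R M q)"
      by (rule sums_num_partitions_pm_residues[OF q(2,1) M R])
    show "(\<lambda>n. real (num_partitions (pm_residues (int ` T) (int M)) n) * q ^ n) sums
        inverse (qtheta_prod T M q)"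
      by (rule sums_num_partitions_pm_residues[OF q(2,1) M T])
    show "inverse (qtheta_prod R M q) - q ^ e * inverse (qtheta_prod T M q) = 1"
      by (rule eq[OF q(2,1)])
  qed
  then show ?thesis by simp
qed

lemma inverse_diff_eq_1:
  fixes a b c s s' t :: "'a :: field"
  assumes "s - c * s' = t" "s = t * inverse a" "s' = t * inverse b" "t \<noteq> 0"
  shows "inverse a - c * inverse b = 1"
proof -
  have "t * (inverse a - c * inverse b) = t * 1"
    using assms(1-3) by (simp add: algebra_simps)
  then show ?thesis using assms(4) by simp
qed

lemma inverse_qtheta_prod_60_diff:
  fixes q :: "'a :: {real_normed_field, banach}"
  assumes q: "norm q < 1" "q \<noteq> 0"
  shows "inverse (qtheta_prod {1, 3, 4, 5, 7, 22, 23, 24, 25, 26, 27, 29} 60 q) -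
      q ^ 1 * inverse (qtheta_prod {1, 2, 3, 7, 11, 19, 23, 24, 26, 27, 28, 29} 60 q) = 1" (is ?i)
    and "inverse (qtheta_prod {2, 7, 9, 11, 12, 13, 14, 16, 17, 19, 21, 23} 60 q) -
      q ^ 2 * inverse (qtheta_prod {2, 5, 7, 9, 11, 12, 19, 21, 23, 25, 26, 28} 60 q) = 1" (is ?ii)
    and "inverse (qtheta_prod {2, 3, 5, 11, 13, 14, 16, 17, 19, 24, 25, 27} 60 q) -
      q ^ 2 * inverse (qtheta_prod {1, 3, 8, 11, 13, 14, 17, 19, 22, 24, 27, 29} 60 q) = 1" (is ?iii)
    and "inverse (qtheta_prod {1, 5, 8, 9, 12, 13, 14, 17, 21, 22, 25, 29} 60 q) -
      q ^ 1 * inverse (qtheta_prod {1, 4, 7, 9, 12, 13, 17, 21, 22, 23, 26, 29} 60 q) = 1" (is ?iv)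
proof -
  define J where "J r = qtheta (q ^ r) (q ^ 60)" for r
  define T where "T r = qtheta (q ^ r) (q ^ 30)" for r
  define S where "S r = qtheta (- (q ^ r)) (q ^ 30)" for r
  have J_nonzero: "J r \<noteq> 0" if "0 < r" "r < 60" for r
    unfolding J_def by (rule qtheta_power_nonzero[OF q that])
  have "J (60 - r) = J r" if "r \<le> 60" for r
    unfolding J_def by (rule qtheta_power_reflect[OF q(2) that])
  from this[of 28] this[of 20] this[of 18] this[of 16]
  have reflect: "J 32 = J 28" "J 40 = J 20" "J 42 = J 18" "J 44 = J 16" by simp_all
  have T_eq: "T r = J r * J (30 - r)" if "r < 30" for r
    using qtheta_power_dissect[OF q that] by (simp add: J_def T_def)
  have S_eq: "S r = J (2 * r) / (J r * J (30 - r))" if "0 < r" "r < 30" for r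
    using qtheta_minus_power[OF q that] by (simp add: J_def S_def)
  have pair: "qtheta_pair (q ^ m) (q ^ n) (q ^ 30) = T (m + n) * T (m - n)"
      "qtheta_pair (- (q ^ m)) (q ^ n) (q ^ 30) = S (m + n) * S (m - n)" if "n \<le> m" for m n
    unfolding T_def S_def by (rule qtheta_pair_powers[OF q(2) that])+
  note pair_simps = pair pair[where n = 1, simplified]
  note J_simps = S_eq T_eq J_nonzero reflect qtheta_prod_def J_def[symmetric]
  note three_term = weierstrass_three_term_powers[OF q, of 30]
  have "S 10 * S 4 * (S 5 * S 3) - q ^ 1 * (S 11 * S 3 * (S 4 * S 2)) = T 8 * T 6 * (T 7 * T 1)"
    using three_term[of "- 1" 3 4 7 1] by (simp add: pair_simps algebra_simps)
  then show ?i by (rule inverse_diff_eq_1) (simp_all add: J_simps field_simps)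
  have "S 13 * S 9 * (S 16 * S 2) - q ^ 2 * (S 20 * S 2 * (S 9 * S 5)) = T 18 * T 4 * (T 11 * T 7)"
    using three_term[of 1 7 9 11 2] by (simp add: pair_simps algebra_simps)
  then show ?ii by (rule inverse_diff_eq_1) (simp_all add: J_simps field_simps)
  have "S 14 * S 10 * (S 5 * S 3) - q ^ 2 * (S 16 * S 8 * (S 3 * S 1)) = T 13 * T 11 * (T 6 * T 2)"
    using three_term[of "- 1" 2 4 12 1] by (simp add: pair_simps algebra_simps)
  then show ?iii by (rule inverse_diff_eq_1) (simp_all add: J_simps field_simps numeral_2_eq_2)
  have "S 21 * S 5 * (S 10 * S 8) - q ^ 1 * (S 22 * S 4 * (S 9 * S 7)) = T 14 * T 12 * (T 17 * T 1)"
    using three_term[of "- 1" 8 9 13 1] by (simp add: pair_simps algebra_simps)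
  then show ?iv by (rule inverse_diff_eq_1) (simp_all add: J_simps field_simps)
qed

theorem theorem12p1:
  shows "(\<forall>n\<ge>1. num_partitions (pm_residues {1, 3, 4, 5, 7, 22, 23, 24, 25, 26, 27, 29} 60) n
        = num_partitions (pm_residues {1, 2, 3, 7, 11, 19, 23, 24, 26, 27, 28, 29} 60) (n - 1)) \<and>
    (\<forall>n\<ge>2. num_partitions (pm_residues {2, 7, 9, 11, 12, 13, 14, 16, 17, 19, 21, 23} 60) n
        = num_partitions (pm_residues {2, 5, 7, 9, 11, 12, 19, 21, 23, 25, 26, 28} 60) (n - 2)) \<and>
    (\<forall>n\<ge>2. num_partitions (pm_residues {2, 3, 5, 11, 13, 14, 16, 17, 19, 24, 25, 27} 60) n
        = num_partitions (pm_residues {1, 3, 8, 11, 13, 14, 17, 19, 22, 24, 27, 29} 60) (n - 2)) \<and>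
    (\<forall>n\<ge>1. num_partitions (pm_residues {1, 5, 8, 9, 12, 13, 14, 17, 21, 22, 25, 29} 60) n
        = num_partitions (pm_residues {1, 4, 7, 9, 12, 13, 17, 21, 22, 23, 26, 29} 60) (n - 1))"
  (is "?i \<and> ?ii \<and> ?iii \<and> ?iv")
proof (intro conjI)
  show ?i
    using num_partitions_pm_residues_shift[OF _ _ _ inverse_qtheta_prod_60_diff(1)] by simp
  show ?ii
    using num_partitions_pm_residues_shift[OF _ _ _ inverse_qtheta_prod_60_diff(2)] by simp
  show ?iii
    using num_partitions_pm_residues_shift[OF _ _ _ inverse_qtheta_prod_60_diff(3)] by simp
  show ?iv
    using num_partitions_pm_residues_shift[OF _ _ _ inverse_qtheta_prod_60_diff(4)] by simp
qed

end
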